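(* Let $K\ge2$ be an integer. If $f_1,\dots,f_K$ are calibrators and $(\lambda_1,\dots,\lambda_K)\in\Delta_K$, then the function $F:[0,1]^{K+1}\to[0,1]$ defined by $$F(\mathbf p,u)=\inf\left\{\alpha\in(0,1):\ \sum_{k=1}^K\lambda_kf_k\left(\frac{p_k}{\alpha}\right)\ge u\right\},\qquad \mathbf p\in[0,1]^K,\ u\in[0,1],$$ with the conventions $\inf\varnothing=1$, $0\times\infty=\infty$, and $f_k(p_k/u)=0$ if $u=0$, is a homogeneous randomized p-merging function. Moreover, $F$ is lower semicontinuous.
   Context: "Increasing"/"decreasing" mean non-decreasing/non-increasing (componentwise for functions of several variables). A calibrator is a decreasing function $f:[0,\infty)\to[0,\infty]$ with $f=0$ on $(1,\infty)$ and $\int_0^1 f(p)\,\mathrm dp\le1$. $\Delta_K=\{\lambda\in[0,1]^K:\sum_k\lambda_k=1\}$ is the standard simplex. Fix an atomless probability space $(\Omega,\mathcal F,\mathbb P)$ (one supporting a random variable uniform on $[0,1]$); $\mathcal U$ is the set of random variables uniform on $[0,1]$, $\mathcal U^K$ the set of random vectors (arbitrary joint distribution) with all $K$ components in $\mathcal U$, and $\mathcal U^K\otimes\mathcal U$ the set of pairs $(\mathbf P,U)\in\mathcal U^K\times\mathcal U$ with $U$ independent of $\mathbf P$. A randomized p-merging function is an increasing Borel function $F:[0,1]^{K+1}\to[0,1]$ such that $\mathbb P(F(\mathbf P,U)\le\alpha)\le\alpha$ for all $\alpha\in(0,1)$ and all $(\mathbf P,U)\in\mathcal U^K\otimes\mathcal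 U$. It is homogeneous if $F(\gamma\mathbf p,u)=\gamma F(\mathbf p,u)$ for all $\gamma\in(0,1]$ and all $(\mathbf p,u)\in[0,1]^{K+1}$.
   Formalization: Homogeneity as defined fails where F = 1 (f_k = 2 on [0,1/2], 0 elsewhere, u = 1, p = (1,…,1), γ = 1/2); what is proved is F(γp,u) = γF(p,u) whenever F(p,u) < 1, and γF(p,u) ≤ F(γp,u) always. *)

theory Defs
  imports "HOL-Probability.Probability"
begin

(* The index set {1..K} is the finite type 'k, with K = CARD('k). *)

(* Calibrators are functions on [0,\<infinity>); values at negative arguments are irrelevant. *)
definition calibrator :: "(real \<Rightarrow> ennreal) \<Rightarrow> bool" where
  "calibrator f \<longleftrightarrow>
     antimono_on {0..} f \<and> (\<forall>p>1. f p = 0) \<and> (\<integral>\<^sup>+p\<in>{0..1}. f p \<partial>lborel) \<le> 1"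

definition std_simplex :: "(real ^ 'k) set" where
  "std_simplex = {l. (\<forall>k. l $ k \<in> {0..1}) \<and> (\<Sum>k\<in>UNIV. l $ k) = 1}"

definition unit_box :: "((real ^ 'k) \<times> real) set" where
  "unit_box = {p. \<forall>k. p $ k \<in> {0..1}} \<times> {0..1}"

(* Uniform random variables are taken to be [0,1]-valued everywhere, not just almost surely,
   so that functions defined on the unit box can be evaluated at them. *)
definition uniform_rvs :: "'a measure \<Rightarrow> ('a \<Rightarrow> real) set" where
  "uniform_rvs M = {U \<in> borel_measurable M.
     (\<forall>\<omega>\<in>space M. U \<omega> \<in> {0..1}) \<and> distr M borel U = uniform_measure lborel {0..1}}"

definition atomless_prob_space :: "'a measure \<Rightarrow> bool" where
  "atomless_prob_space M \<longleftrightarrow> prob_space M \<and> uniform_rvs M \<noteq> {}"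

definition uniform_rvecs :: "'a measure \<Rightarrow> ('a \<Rightarrow> real ^ 'k) set" where
  "uniform_rvecs M = {P. \<forall>k. (\<lambda>\<omega>. P \<omega> $ k) \<in> uniform_rvs M}"

(* Independence of P and U is independence of the sigma-algebras they generate; indep_var
   does not apply because P and U have different types. *)
definition uniform_rvecs_indep :: "'a measure \<Rightarrow> (('a \<Rightarrow> real ^ 'k) \<times> ('a \<Rightarrow> real)) set" where
  "uniform_rvecs_indep M =
     {(P, U). P \<in> uniform_rvecs M \<and> U \<in> uniform_rvs M \<and>
        prob_space.indep_set M {P -` A \<inter> space M |A. A \<in> sets borel}
                               {U -` B \<inter> space M |B. B \<in> sets borel}}"

(* The order on (real ^ 'k) \<times> real is the componentwise one. *)
definition randomized_p_merging :: "'a measure \<Rightarrow> ((real ^ 'k) \<times> real \<Rightarrow> real) \<Rightarrow> bool" where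
  "randomized_p_merging M F \<longleftrightarrow>
     F \<in> unit_box \<rightarrow> {0..1} \<and>
     mono_on unit_box F \<and>
     F \<in> borel_measurable (restrict_space borel unit_box) \<and>
     (\<forall>\<alpha>\<in>{0<..<1}. \<forall>(P, U)\<in>uniform_rvecs_indep M.
        measure M {\<omega> \<in> space M. F (P \<omega>, U \<omega>) \<le> \<alpha>} \<le> \<alpha>)"

(* Homogeneity of a function that is capped at 1. The equation F (\<gamma>p, u) = \<gamma> F (p, u) is
   required wherever the cap is not attained. Requiring it also where F (p, u) = 1 is too much:
   if every f k is 2 on [0, 1/2] and 0 elsewhere, then merge_fun below takes the value
   min (2c) 1 at p = (c, ..., c), u = 1, hence the value 1 both at c = 1 and at c = 1/2. What
   remains at the cap is the inequality. The two clauses together say that F = min G 1 on the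
   box for some [0,\<infinity>]-valued G that satisfies the equation everywhere. *)
definition capped_homogeneous :: "((real ^ 'k) \<times> real \<Rightarrow> real) \<Rightarrow> bool" where
  "capped_homogeneous F \<longleftrightarrow>
     (\<forall>\<gamma>\<in>{0<..1}. \<forall>(p, u)\<in>unit_box.
        (F (p, u) < 1 \<longrightarrow> F (\<gamma> *\<^sub>R p, u) = \<gamma> * F (p, u)) \<and>
        \<gamma> * F (p, u) \<le> F (\<gamma> *\<^sub>R p, u))"

definition lower_semicontinuous_on ::
    "'a::topological_space set \<Rightarrow> ('a \<Rightarrow> real) \<Rightarrow> bool" where
  "lower_semicontinuous_on S F \<longleftrightarrow>
     (\<forall>x\<in>S. \<forall>a<F x. \<forall>\<^sub>F y in at x within S. a < F y)"

(* Multiplication with 0 \<times> \<infinity> = \<infinity>; the library has 0 * \<infinity> = 0 on ennreal. *)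
definition times_inf :: "ennreal \<Rightarrow> ennreal \<Rightarrow> ennreal" where
  "times_inf a b = (if a = \<infinity> \<or> b = \<infinity> then \<infinity> else a * b)"

(* The scale \<alpha> is positive, so the quotient p $ k / \<alpha> never has a zero denominator. *)
definition merge_levels ::
    "('k \<Rightarrow> real \<Rightarrow> ennreal) \<Rightarrow> real ^ 'k \<Rightarrow> real ^ 'k \<Rightarrow> real \<Rightarrow> real set" where
  "merge_levels f l p u =
     {\<alpha>\<in>{0<..<1}. (\<Sum>k\<in>UNIV. times_inf (ennreal (l $ k)) (f k (p $ k / \<alpha>))) \<ge> ennreal u}"

definition merge_fun ::
    "('k \<Rightarrow> real \<Rightarrow> ennreal) \<Rightarrow> real ^ 'k \<Rightarrow> (real ^ 'k) \<times> real \<Rightarrow> real" where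
  "merge_fun f l = (\<lambda>(p, u).
     if merge_levels f l p u = {} then 1 else Inf (merge_levels f l p u))"

end

theory Submission
  imports Defs
begin

text \<open>
  As each \<open>f k\<close> is decreasing, the admissible levels \<open>\<alpha>\<close> form an up-set of \<open>(0, 1)\<close>. So the
  infimum lies strictly below \<open>\<alpha>\<close> only if \<open>\<alpha>\<close> is admissible, and it is at most \<open>\<alpha>\<close> whenever
  \<open>\<alpha>\<close> is; monotonicity, homogeneity and lower semicontinuity follow by comparing admissible
  levels. For the validity, let \<open>\<alpha> < \<beta> < 1\<close>. On \<open>F (P, U) \<le> \<alpha>\<close> the level \<open>\<beta>\<close> is admissible,
  that is \<open>U \<le> Z\<close> with \<open>Z = \<Sum>k. \<lambda>\<^sub>k f\<^sub>k (P\<^sub>k / \<beta>)\<close>. Since \<open>U\<close> is uniform and independent of \<open>Z\<close>,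
  this event has probability at most \<open>E Z = \<Sum>k. \<lambda>\<^sub>k \<beta> \<integral> f\<^sub>k \<le> \<beta>\<close>. Let \<open>\<beta>\<close> tend to \<open>\<alpha>\<close>.
\<close>

section \<open>Admissible levels\<close>

definition merge_sum ::
    "('k::finite \<Rightarrow> real \<Rightarrow> ennreal) \<Rightarrow> real ^ 'k \<Rightarrow> real ^ 'k \<Rightarrow> real \<Rightarrow> ennreal" where
  "merge_sum f l p \<alpha> = (\<Sum>k\<in>UNIV. times_inf (ennreal (l $ k)) (f k (p $ k / \<alpha>)))"

lemma merge_levels_iff:
  "\<alpha> \<in> merge_levels f l p u \<longleftrightarrow> 0 < \<alpha> \<and> \<alpha> < 1 \<and> ennreal u \<le> merge_sum f l p \<alpha>"
  by (auto simp: merge_levels_def merge_sum_def)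

lemma times_inf_mono: "b \<le> c \<Longrightarrow> times_inf a b \<le> times_inf a c"
  by (auto simp: times_inf_def top_unique intro: mult_left_mono)

text \<open>Only the ratios of components to level matter, so the level and the vector may change
  together; lower semicontinuity needs both at once.\<close>

lemma merge_sum_antimono:
  assumes "\<And>k. antimono_on {0..} (f k)"
    and "\<And>k. 0 \<le> p $ k / \<alpha>" "\<And>k. p $ k / \<alpha> \<le> q $ k / \<beta>"
  shows "merge_sum f l q \<beta> \<le> merge_sum f l p \<alpha>"
  unfolding merge_sum_def
proof (intro sum_mono times_inf_mono)
  fix k
  show "f k (q $ k / \<beta>) \<le> f k (p $ k / \<alpha>)"
    using assms(2,3)[of k] by (intro monotone_onD[OF assms(1)]) auto
qed

lemma merge_fun_le: "\<alpha> \<in> merge_levels f l p u \<Longrightarrow> merge_fun f l (p, u) \<le> \<alpha>"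
  by (auto simp: merge_fun_def merge_levels_iff intro!: cInf_lower bdd_belowI[of _ 0])

lemma merge_fun_nonneg: "0 \<le> merge_fun f l (p, u)"
  by (auto simp: merge_fun_def merge_levels_iff intro!: cInf_greatest)

lemma merge_fun_le_1: "merge_fun f l (p, u) \<le> 1"
proof (cases "merge_levels f l p u = {}")
  case False
  then obtain \<alpha> where "\<alpha> \<in> merge_levels f l p u" by blast
  with merge_fun_le[OF this] show ?thesis by (simp add: merge_levels_iff)
qed (simp add: merge_fun_def)

text \<open>Some admissible level lies below \<open>\<alpha>\<close>, and admissibility passes to
  larger levels under 1. This is the converse of \<open>merge_fun_le\<close>. The inequality is
  strict because the infimum need not be attained.\<close>

lemma merge_levels_if_merge_fun_less:
  assumes f: "\<And>k. antimono_on {0..} (f k)" and p: "\<And>k. 0 \<le> p $ k"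
    and less: "merge_fun f l (p, u) < \<alpha>" and "\<alpha> < 1"
  shows "\<alpha> \<in> merge_levels f l p u"
proof -
  \<comment> \<open>A value below 1 cannot come from the convention for the empty set.\<close>
  have ne: "merge_levels f l p u \<noteq> {}"
    using assms by (auto simp: merge_fun_def)
  then have "Inf (merge_levels f l p u) < \<alpha>"
    using less by (simp add: merge_fun_def)
  with ne obtain \<beta> where \<beta>: "\<beta> \<in> merge_levels f l p u" "\<beta> < \<alpha>"
    by (meson cInf_lessD)
  then have "merge_sum f l p \<beta> \<le> merge_sum f l p \<alpha>"
    using p by (intro merge_sum_antimono[OF f]) (auto simp: merge_levels_iff intro!: divide_left_mono)
  with \<beta> \<open>\<alpha> < 1\<close> show ?thesis
    by (auto simp: merge_levels_iff)
qed

lemma merge_fun_mono: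
  assumes f: "\<And>k. antimono_on {0..} (f k)" and p: "\<And>k. 0 \<le> p $ k"
    and pq: "\<And>k. p $ k \<le> q $ k" and "u \<le> v"
  shows "merge_fun f l (p, u) \<le> merge_fun f l (q, v)"
proof (rule ccontr)
  assume "\<not> ?thesis"
  \<comment> \<open>Such a \<open>c\<close> would be admissible for \<open>(q, v)\<close>. Passing
    to \<open>(p, u)\<close> enlarges the sum and lowers the threshold, so \<open>c\<close> would be
    admissible there too, against \<open>c < merge_fun f l (p, u)\<close>.\<close>
  then obtain c where c: "merge_fun f l (q, v) < c" "c < merge_fun f l (p, u)"
    by (meson dense not_le)
  then have "c < 1" using merge_fun_le_1[of f l p u] by simp
  have "c \<in> merge_levels f l q v"
    using c(1) p pq \<open>c < 1\<close> by (intro merge_levels_if_merge_fun_less f) (auto intro: order_trans)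
  moreover have "merge_sum f l q c \<le> merge_sum f l p c" if "0 < c"
    using p pq that by (intro merge_sum_antimono f divide_right_mono) auto
  ultimately have "c \<in> merge_levels f l p u"
    using \<open>u \<le> v\<close> by (auto simp: merge_levels_iff intro: order_trans ennreal_leI)
  from merge_fun_le[OF this] c(2) show False by simp
qed

section \<open>Homogeneity up to the cap\<close>

lemma merge_sum_scaleR: "merge_sum f l (\<gamma> *\<^sub>R p) (\<gamma> * \<beta>) = merge_sum f l p \<beta>" if "\<gamma> \<noteq> 0"
  using that by (simp add: merge_sum_def)

text \<open>Scaling vector and level together keeps the ratios. The cap does no harm in this
  direction: a level below \<open>\<gamma> * merge_fun f l (p, u)\<close> stays below 1 after
  division by \<open>\<gamma>\<close>.\<close>

lemma merge_fun_scaleR_ge: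
  assumes f: "\<And>k. antimono_on {0..} (f k)" and p: "\<And>k. 0 \<le> p $ k" and \<gamma>: "0 < \<gamma>" "\<gamma> \<le> 1"
  shows "\<gamma> * merge_fun f l (p, u) \<le> merge_fun f l (\<gamma> *\<^sub>R p, u)"
proof (rule ccontr)
  assume "\<not> ?thesis"
  then obtain c where c: "merge_fun f l (\<gamma> *\<^sub>R p, u) < c" "c < \<gamma> * merge_fun f l (p, u)"
    by (meson dense not_le)
  have less: "c / \<gamma> < merge_fun f l (p, u)"
    using c(2) \<gamma> by (simp add: field_simps)
  then have "c / \<gamma> < 1" using merge_fun_le_1[of f l p u] by simp
  then have "c < 1" using \<gamma> by (simp add: field_simps)
  then have "c \<in> merge_levels f l (\<gamma> *\<^sub>R p) u"
    using p c \<gamma> by (intro merge_levels_if_merge_fun_less f) auto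
  then have "c / \<gamma> \<in> merge_levels f l p u"
    using merge_sum_scaleR[of \<gamma> f l p "c / \<gamma>"] \<gamma> \<open>c / \<gamma> < 1\<close> by (auto simp: merge_levels_iff)
  from merge_fun_le[OF this] less show False by simp
qed

text \<open>A value below 1 leaves room for admissible levels \<open>c < 1\<close>, which scale to
  levels of \<open>\<gamma> *\<^sub>R p\<close>. If the value is 1, all levels of the scaled vector
  may lie in \<open>{\<gamma>..<1}\<close>, where nothing corresponds to them.\<close>

lemma merge_fun_scaleR_le:
  assumes f: "\<And>k. antimono_on {0..} (f k)" and p: "\<And>k. 0 \<le> p $ k" and \<gamma>: "0 < \<gamma>" "\<gamma> \<le> 1"
    and less: "merge_fun f l (p, u) < 1"
  shows "merge_fun f l (\<gamma> *\<^sub>R p, u) \<le> \<gamma> * merge_fun f l (p, u)"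
proof -
  have "merge_fun f l (\<gamma> *\<^sub>R p, u) / \<gamma> \<le> c" if "merge_fun f l (p, u) < c" "c < 1" for c
  proof -
    have "c \<in> merge_levels f l p u"
      using that by (intro merge_levels_if_merge_fun_less f p)
    moreover have "\<gamma> * c < 1"
      using \<open>c < 1\<close> \<gamma> mult_strict_left_mono[of c 1 \<gamma>] by linarith
    ultimately have "\<gamma> * c \<in> merge_levels f l (\<gamma> *\<^sub>R p) u"
      using \<gamma> by (auto simp: merge_levels_iff merge_sum_scaleR)
    from merge_fun_le[OF this] \<gamma> show ?thesis by (simp add: field_simps)
  qed
  then have "merge_fun f l (\<gamma> *\<^sub>R p, u) / \<gamma> \<le> merge_fun f l (p, u)"
    by (intro dense_ge_bounded[OF less])
  with \<gamma> show ?thesis by (simp add: field_simps)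
qed

lemma capped_homogeneous_merge_fun:
  assumes "\<And>k. antimono_on {0..} (f k)"
  shows "capped_homogeneous (merge_fun f l)"
  unfolding capped_homogeneous_def
proof (intro ballI, clarify)
  fix \<gamma> u :: real and p :: "real ^ 'a"
  assume "\<gamma> \<in> {0<..1}" and "(p, u) \<in> unit_box"
  then have "0 < \<gamma>" "\<gamma> \<le> 1" "\<And>k. 0 \<le> p $ k"
    by (auto simp: unit_box_def)
  then show "(merge_fun f l (p, u) < 1 \<longrightarrow>
      merge_fun f l (\<gamma> *\<^sub>R p, u) = \<gamma> * merge_fun f l (p, u)) \<and>
      \<gamma> * merge_fun f l (p, u) \<le> merge_fun f l (\<gamma> *\<^sub>R p, u)"
    using merge_fun_scaleR_ge[of f, OF assms] merge_fun_scaleR_le[of f, OF assms]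
    by (auto intro: antisym)
qed

section \<open>Lower semicontinuity\<close>

text \<open>Take \<open>a < b < c\<close> with \<open>c\<close> below the value at
  \<open>(p, u)\<close>. The sum at \<open>c\<close> is then strictly below \<open>u\<close>. The
  gap between \<open>b\<close> and \<open>c\<close> absorbs small changes of \<open>p\<close>, so no
  continuity of \<open>f k\<close> is required: near \<open>(p, u)\<close> the level
  \<open>b\<close> stays inadmissible.\<close>

lemma lower_semicontinuous_on_merge_fun:
  assumes f: "\<And>k. antimono_on {0..} (f k)"
  shows "lower_semicontinuous_on unit_box (merge_fun f l)"
  unfolding lower_semicontinuous_on_def
proof (intro ballI allI impI)
  fix x :: "(real ^ 'a) \<times> real" and a :: real
  assume x: "x \<in> unit_box" and a: "a < merge_fun f l x"
  obtain p u where x_eq: "x = (p, u)" by (cases x)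
  have p: "0 \<le> p $ k" for k using x by (auto simp: unit_box_def x_eq)
  show "\<forall>\<^sub>F y in at x within unit_box. a < merge_fun f l y"
  proof (cases "a < 0")
    case True
    then have "a < merge_fun f l y" for y
      by (cases y) (auto intro!: less_le_trans[OF _ merge_fun_nonneg])
    then show ?thesis by simp
  next
    case False
    obtain c where c: "a < c" "c < merge_fun f l (p, u)"
      using dense[of a "merge_fun f l (p, u)"] a x_eq by blast
    obtain b where b: "a < b" "b < c" using dense[OF c(1)] by blast
    have pos: "0 < b" "0 < c" and "c < 1"
      using False b c merge_fun_le_1[of f l p u] by auto
    \<comment> \<open>The sum at \<open>c\<close> is below \<open>u\<close>, hence finite, and can
      be compared with nearby thresholds as a real number.\<close>
    define s where "s = enn2real (merge_sum f l p c)"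
    have "c \<notin> merge_levels f l p u" using merge_fun_le c(2) by fastforce
    then have less: "merge_sum f l p c < ennreal u"
      using pos \<open>c < 1\<close> by (auto simp: merge_levels_iff)
    then have s: "merge_sum f l p c = ennreal s"
      unfolding s_def using less_trans[OF less ennreal_less_top] by simp
    have "0 \<le> s" by (simp add: s_def)
    then have "s < u" using less s by (simp add: ennreal_less_iff)
    have ev_u: "\<forall>\<^sub>F y in at x within unit_box. s < snd y"
      by (rule order_tendstoD(1)[OF _ \<open>s < u\<close>]) (auto simp: x_eq intro!: tendsto_eq_intros)
    have ev_p: "\<forall>\<^sub>F y in at x within unit_box. p $ k / c \<le> fst y $ k / b" for k
    \<comment> \<open>At a zero component both ratios of \<open>p\<close> vanish and there is no
      strict gap; nonnegativity of points of the box replaces it.\<close>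
    proof (cases "p $ k = 0")
      case True
      have "\<forall>\<^sub>F y in at x within unit_box. y \<in> unit_box"
        by (auto simp: eventually_at_filter)
      then show ?thesis
        by eventually_elim (use True pos in \<open>auto simp: unit_box_def\<close>)
    next
      case False
      then have "p $ k / c < p $ k / b"
        using p[of k] b pos by (intro divide_strict_left_mono) auto
      moreover have "((\<lambda>y. fst y $ k / b) \<longlongrightarrow> p $ k / b) (at x within unit_box)"
        using pos by (auto simp: x_eq intro!: tendsto_eq_intros)
      ultimately have "\<forall>\<^sub>F y in at x within unit_box. p $ k / c < fst y $ k / b"
        by (intro order_tendstoD)
      then show ?thesis by eventually_elim simp
    qed
    have "\<forall>\<^sub>F y in at x within unit_box. y \<in> unit_box"
      by (auto simp: eventually_at_filter)
    moreover have "\<forall>\<^sub>F y in at x within unit_box. \<forall>k. p $ k / c \<le> fst y $ k / b"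
      using ev_p by (simp add: eventually_all_finite)
    ultimately show ?thesis
      using ev_u
    proof eventually_elim
      case (elim y)
      obtain q v where y: "y = (q, v)" by (cases y)
      have q: "0 \<le> q $ k" for k using elim(1) by (auto simp: unit_box_def y)
      have "merge_sum f l q b \<le> merge_sum f l p c"
        using elim p pos by (intro merge_sum_antimono f) (auto simp: y)
      also have "\<dots> < ennreal v"
        using elim \<open>0 \<le> s\<close> by (simp add: s y ennreal_lessI)
      finally have "b \<notin> merge_levels f l q v" by (auto simp: merge_levels_iff)
      then have "b \<le> merge_fun f l (q, v)"
        using merge_levels_if_merge_fun_less[of f q l v b, OF f q] b \<open>c < 1\<close> by force
      with b show ?case by (simp add: y)
    qed
  qed
qed

text \<open>Strict superlevel sets are relatively open: each is the trace on \<open>S\<close> of the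
  union of all open sets on whose trace the bound holds.\<close>

lemma lower_semicontinuous_on_imp_borel_measurable:
  assumes "lower_semicontinuous_on S F"
  shows "F \<in> borel_measurable (restrict_space borel S)"
proof (rule borel_measurableI_greater)
  fix a
  let ?T = "\<Union>{T. open T \<and> (\<forall>y\<in>T \<inter> S. a < F y)}"
  have "\<exists>T. open T \<and> x \<in> T \<and> (\<forall>y\<in>T \<inter> S. a < F y)" if x: "x \<in> S" "a < F x" for x
  proof -
    have "\<forall>\<^sub>F y in at x within S. a < F y"
      using assms x by (auto simp: lower_semicontinuous_on_def)
    then obtain T where "open T" "x \<in> T" "\<forall>y\<in>T. y \<noteq> x \<longrightarrow> y \<in> S \<longrightarrow> a < F y"
      by (auto simp: eventually_at_topological)
    \<comment> \<open>The filter \<open>at x within S\<close> omits \<open>x\<close> itself, where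
      the bound is \<open>a < F x\<close>.\<close>
    with x show ?thesis by (intro exI[of _ T]) auto
  qed
  then have "{x \<in> S. a < F x} = S \<inter> ?T"
    by auto
  moreover have "open ?T" by auto
  ultimately show "{x \<in> space (restrict_space borel S). a < F x} \<in> sets (restrict_space borel S)"
    by (auto simp: space_restrict_space sets_restrict_space)
qed

section \<open>Calibrators\<close>

text \<open>A strict superlevel set is closed downwards: a closed ray if it has a maximum, otherwise
  a union of open rays.\<close>

lemma borel_measurable_antimono:
  fixes g :: "real \<Rightarrow> 'b::{linorder_topology, second_countable_topology}"
  assumes "antimono g"
  shows "g \<in> borel_measurable borel"
proof (rule borel_measurableI_greater)
  fix y
  let ?D = "{x. y < g x}"
  have down: "x \<in> ?D" if "x' \<in> ?D" "x \<le> x'" for x x'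
    using that antimonoD[OF assms, of x x'] by auto
  have "?D \<in> sets borel"
  proof (cases "\<exists>m\<in>?D. \<forall>x\<in>?D. x \<le> m")
    case True
    then obtain m where "m \<in> ?D" "\<forall>x\<in>?D. x \<le> m" by blast
    then have "?D = {..m}" using down by blast
    then show ?thesis by simp
  next
    case False
    then have "?D = (\<Union>m\<in>?D. {..<m})"
      using down by (fastforce simp: not_le)
    then have "open ?D" by (metis open_UN open_lessThan)
    then show ?thesis by simp
  qed
  then show "{x \<in> space borel. y < g x} \<in> sets borel" by simp
qed

text \<open>Clipping at 0 replaces the arbitrary values at negative arguments by \<open>f 0\<close>,
  which makes the function decreasing on the whole line.\<close>

lemma calibrator_measurable:
  assumes "calibrator f"
  shows "(\<lambda>x. f (max 0 x)) \<in> borel_measurable borel"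
proof (rule borel_measurable_antimono, rule antimonoI)
  fix x y :: real assume "x \<le> y"
  then show "f (max 0 y) \<le> f (max 0 x)"
    using assms by (intro monotone_onD[of "{0..}" "(\<le>)" "(\<ge>)" f]) (auto simp: calibrator_def)
qed

text \<open>For \<open>x \<le> 1\<close>, monotonicity bounds \<open>f x * x\<close> by the integral
  of \<open>f\<close>, which is at most 1.\<close>

lemma calibrator_finite:
  assumes "calibrator f" "0 < x"
  shows "f x < \<infinity>"
proof (cases "x \<le> 1")
  case True
  have "f x * ennreal x = (\<integral>\<^sup>+p. f x * indicator {0..x} p \<partial>lborel)"
    using \<open>0 < x\<close> by (simp add: nn_integral_cmult_indicator)
  also have "\<dots> \<le> (\<integral>\<^sup>+p\<in>{0..1}. f p \<partial>lborel)"
  proof (intro nn_integral_mono)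
    fix p
    have "f x \<le> f p" if "0 \<le> p" "p \<le> x"
      using assms that by (intro monotone_onD[of "{0..}" "(\<le>)" "(\<ge>)" f]) (auto simp: calibrator_def)
    then show "f x * indicator {0..x} p \<le> f p * indicator {0..1} p"
      using True by (auto simp: indicator_def)
  qed
  also have "\<dots> \<le> 1" using assms by (simp add: calibrator_def)
  finally have le: "f x * ennreal x \<le> 1" .
  show ?thesis
  proof (rule ccontr)
    assume "\<not> f x < \<infinity>"
    then have "f x = \<infinity>" by (metis infinity_ennreal_def less_top)
    with le \<open>0 < x\<close> show False by (simp add: ennreal_top_mult top_unique)
  qed
next
  case False
  then show ?thesis using assms by (auto simp: calibrator_def)
qed

lemma nn_integral_calibrator_divide:
  assumes f: "calibrator f" and \<beta>: "0 < \<beta>"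
  shows "(\<integral>\<^sup>+x\<in>{0..1}. f (max 0 (x / \<beta>)) \<partial>lborel) \<le> ennreal \<beta>"
proof -
  note [measurable] = calibrator_measurable[OF f]
  have "(\<integral>\<^sup>+x\<in>{0..1}. f (max 0 (x / \<beta>)) \<partial>lborel) =
      ennreal \<beta> * (\<integral>\<^sup>+x. f (max 0 x) * indicator {0..1} (\<beta> * x) \<partial>lborel)"
    using \<beta> by (subst nn_integral_real_affine[of _ \<beta> 0]) auto
  \<comment> \<open>After the substitution the range is \<open>0 \<le> x \<le> 1 / \<beta>\<close>;
    any part of it beyond 1 contributes nothing, since \<open>f\<close> vanishes there.\<close>
  also have "\<dots> \<le> ennreal \<beta> * (\<integral>\<^sup>+x\<in>{0..1}. f x \<partial>lborel)"
    using f \<beta> by (intro mult_left_mono nn_integral_mono)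
      (auto simp: indicator_def calibrator_def zero_le_mult_iff)
  also have "\<dots> \<le> ennreal \<beta> * 1"
    using f by (intro mult_left_mono) (auto simp: calibrator_def)
  finally show ?thesis by simp
qed

section \<open>Validity\<close>

lemma nn_integral_uniform_rvs:
  assumes U: "U \<in> uniform_rvs M" and h[measurable]: "h \<in> borel_measurable borel"
  shows "(\<integral>\<^sup>+\<omega>. h (U \<omega>) \<partial>M) = (\<integral>\<^sup>+x\<in>{0..1}. h x \<partial>lborel)"
proof -
  have [measurable]: "U \<in> borel_measurable M" using U by (simp add: uniform_rvs_def)
  have "(\<integral>\<^sup>+\<omega>. h (U \<omega>) \<partial>M) = (\<integral>\<^sup>+x. h x \<partial>distr M borel U)"
    by (simp add: nn_integral_distr)
  also have "distr M borel U = uniform_measure lborel {0..1}"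
    using U by (simp add: uniform_rvs_def)
  finally show ?thesis by (simp add: nn_integral_uniform_measure divide_ennreal_def)
qed

lemma AE_uniform_rvs_pos:
  assumes U: "U \<in> uniform_rvs M"
  shows "AE \<omega> in M. 0 < U \<omega>"
proof -
  have [measurable]: "U \<in> borel_measurable M" using U by (simp add: uniform_rvs_def)
  have "(\<integral>\<^sup>+\<omega>. indicator {..0} (U \<omega>) \<partial>M) = (\<integral>\<^sup>+x. indicator {..0::real} x * indicator {0..1} x \<partial>lborel)"
    by (rule nn_integral_uniform_rvs[OF U]) simp
  also have "\<dots> = (\<integral>\<^sup>+x. indicator {0::real} x \<partial>lborel)"
    by (intro nn_integral_cong) (auto simp: indicator_def)
  finally have "AE \<omega> in M. indicator {..0} (U \<omega>) = (0::ennreal)"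
    by (simp add: nn_integral_0_iff_AE)
  then show ?thesis by eventually_elim (auto simp: indicator_def split: if_splits)
qed

text \<open>By independence the joint law is a product, so Fubini applies: for fixed
  \<open>z\<close> in the unit interval, \<open>U \<le> z\<close> has probability
  \<open>z\<close>.\<close>

lemma (in prob_space) emeasure_uniform_le_eq_nn_integral:
  assumes U: "U \<in> uniform_rvs M" and ind: "indep_var borel Z borel U"
    and Z: "\<And>\<omega>. Z \<omega> \<in> {0..1}"
  shows "emeasure M {\<omega> \<in> space M. U \<omega> \<le> Z \<omega>} = (\<integral>\<^sup>+\<omega>. ennreal (Z \<omega>) \<partial>M)"
proof -
  have [measurable]: "U \<in> borel_measurable M" "Z \<in> borel_measurable M"
    using indep_var_rv1[OF ind] indep_var_rv2[OF ind] by simp_all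
  let ?A = "{x :: real \<times> real. snd x \<le> fst x}"
  interpret Udist: prob_space "distr M borel U" by (rule prob_space_distr) simp
  have A[measurable]: "?A \<in> sets (borel \<Otimes>\<^sub>M borel)"
    unfolding borel_prod by (intro borel_closed closed_Collect_le continuous_intros)
  have "emeasure M {\<omega> \<in> space M. U \<omega> \<le> Z \<omega>} =
      emeasure (distr M (borel \<Otimes>\<^sub>M borel) (\<lambda>\<omega>. (Z \<omega>, U \<omega>))) ?A"
    by (subst emeasure_distr) (auto intro!: arg_cong[of _ _ "emeasure M"])
  also have "\<dots> = emeasure (distr M borel Z \<Otimes>\<^sub>M distr M borel U) ?A"
    using ind by (simp add: indep_var_distribution_eq)
  also have "\<dots> = (\<integral>\<^sup>+z. emeasure (distr M borel U) (Pair z -` ?A) \<partial>distr M borel Z)"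
    by (rule Udist.emeasure_pair_measure_alt) (simp cong: sets_pair_measure_cong)
  \<comment> \<open>The clipped value covers every real \<open>z\<close>; the range of
    \<open>Z\<close> removes the clipping afterwards.\<close>
  also have "\<dots> = (\<integral>\<^sup>+z. ennreal (max 0 (min 1 z)) \<partial>distr M borel Z)"
  proof (intro nn_integral_cong)
    fix z :: real
    have "{0..1} \<inter> {..z} = {0..min 1 z}" by auto
    then have "emeasure (uniform_measure lborel {0..1}) {..z} = ennreal (max 0 (min 1 z))"
      by (simp add: divide_ennreal_def max_def)
    moreover have "Pair z -` ?A = {..z}" by auto
    ultimately show "emeasure (distr M borel U) (Pair z -` ?A) = ennreal (max 0 (min 1 z))"
      using U by (simp add: uniform_rvs_def)
  qed
  also have "\<dots> = (\<integral>\<^sup>+\<omega>. ennreal (max 0 (min 1 (Z \<omega>))) \<partial>M)"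
    by (rule nn_integral_distr) auto
  also have "\<dots> = (\<integral>\<^sup>+\<omega>. ennreal (Z \<omega>) \<partial>M)"
    using Z by (intro nn_integral_cong) (auto simp: max_def min_def intro: antisym)
  finally show ?thesis .
qed

text \<open>Preimages under \<open>g (P \<omega>)\<close> are preimages under \<open>P\<close>.
  Intersection stability lifts independence to the generated sigma-algebras that
  \<open>indep_var\<close> refers to.\<close>

lemma (in prob_space) indep_var_borel_comp:
  fixes P :: "'a \<Rightarrow> 'b::topological_space" and U :: "'a \<Rightarrow> real" and g :: "'b \<Rightarrow> real"
  assumes P[measurable]: "P \<in> borel_measurable M" and U[measurable]: "U \<in> borel_measurable M"
    and g[measurable]: "g \<in> borel_measurable borel"
    and ind: "indep_set {P -` A \<inter> space M |A. A \<in> sets borel} {U -` B \<inter> space M |B. B \<in> sets borel}"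
  shows "indep_var borel (\<lambda>\<omega>. g (P \<omega>)) borel U"
proof -
  let ?X = "{(\<lambda>\<omega>. g (P \<omega>)) -` A \<inter> space M |A. A \<in> sets borel}"
  let ?Y = "{U -` B \<inter> space M |B. B \<in> sets borel}"
  have "?X \<subseteq> {P -` A \<inter> space M |A. A \<in> sets borel}"
  proof safe
    fix A :: "real set" assume "A \<in> sets borel"
    then show "\<exists>B. (\<lambda>\<omega>. g (P \<omega>)) -` A \<inter> space M = P -` B \<inter> space M \<and> B \<in> sets borel"
      using measurable_sets[OF g, of A] by (intro exI[of _ "g -` A"]) auto
  qed
  then have "indep_set ?X ?Y"
    using ind unfolding indep_sets2_eq by (meson subset_iff order_trans)
  moreover have "Int_stable {h -` A \<inter> space M |A. A \<in> sets borel}" for h :: "'a \<Rightarrow> real"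
  proof (rule Int_stableI, safe)
    fix A B :: "real set" assume "A \<in> sets borel" "B \<in> sets borel"
    then show "\<exists>C. h -` A \<inter> space M \<inter> (h -` B \<inter> space M) = h -` C \<inter> space M \<and> C \<in> sets borel"
      by (intro exI[of _ "A \<inter> B"]) auto
  qed
  ultimately show ?thesis
    unfolding indep_var_eq by (auto intro!: indep_set_sigma_sets)
qed

lemma (in prob_space) prob_merge_fun_le:
  fixes f :: "'k::finite \<Rightarrow> real \<Rightarrow> ennreal"
  assumes f: "\<And>k. calibrator (f k)" and l: "l \<in> std_simplex"
    and PU: "(P, U) \<in> uniform_rvecs_indep M" and \<beta>: "0 < \<beta>" "\<beta> < 1" and "\<alpha> < \<beta>"
  shows "prob {\<omega> \<in> space M. merge_fun f l (P \<omega>, U \<omega>) \<le> \<alpha>} \<le> \<beta>"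
proof -
  have P: "(\<lambda>\<omega>. P \<omega> $ k) \<in> uniform_rvs M" for k
    using PU by (auto simp: uniform_rvecs_indep_def uniform_rvecs_def)
  have U: "U \<in> uniform_rvs M"
    and ind: "indep_set {P -` A \<inter> space M |A. A \<in> sets borel} {U -` B \<inter> space M |B. B \<in> sets borel}"
    using PU by (auto simp: uniform_rvecs_indep_def uniform_rvecs_def)
  have l_nonneg: "0 \<le> l $ k" for k using l by (simp add: std_simplex_def)
  have f_mono: "antimono_on {0..} (f k)" for k using f by (simp add: calibrator_def)
  have [measurable]: "(\<lambda>\<omega>. P \<omega> $ k) \<in> borel_measurable M" for k
    using P by (simp add: uniform_rvs_def)
  have P_meas: "P \<in> borel_measurable M"
    unfolding borel_measurable_euclidean_space[of P]
    by (auto simp: Basis_vec_def inner_axis)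
  have U_meas[measurable]: "U \<in> borel_measurable M"
    using U by (simp add: uniform_rvs_def)
  note [measurable] = calibrator_measurable[OF f]
  define T where "T p = (\<Sum>k\<in>UNIV. ennreal (l $ k) * f k (max 0 (p $ k / \<beta>)))" for p :: "real ^ 'k"
  \<comment> \<open>Truncation at 1 yields a real variable in the unit interval. It does not affect
    the comparison with \<open>U\<close>, since \<open>U\<close> is at most 1, and dropping it later
    only enlarges the expectation.\<close>
  define g where "g p = enn2real (min 1 (T p))" for p
  have comp: "(\<lambda>p::real ^ 'k. p $ k) \<in> borel_measurable borel" for k
    by (intro borel_measurable_continuous_onI continuous_intros)
  have T_meas: "T \<in> borel_measurable borel"
    unfolding T_def using comp[measurable] by measurable
  have g_meas: "g \<in> borel_measurable borel"
    unfolding g_def using T_meas by measurable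
  have g_eq: "ennreal (g p) = min 1 (T p)" for p
    unfolding g_def by (intro ennreal_enn2real) (simp add: min_less_iff_disj)
  have g_01: "g p \<in> {0..1}" for p
    using g_eq[of p] by (auto simp: g_def) (metis enn2real_1 enn2real_mono ennreal_one_less_top min.cobounded1)
  have "{\<omega> \<in> space M. U \<omega> \<le> g (P \<omega>)} \<in> events"
    using measurable_compose[OF P_meas g_meas] by measurable
  \<comment> \<open>The convention \<open>0 \<times> \<infinity> = \<infinity>\<close> only matters at zero components, as \<open>f k\<close> is finite on \<open>(0, \<infinity>)\<close>.\<close>
  moreover have "AE \<omega> in M. \<forall>k. 0 < P \<omega> $ k"
    using AE_uniform_rvs_pos[OF P] by (simp add: AE_all_countable)
  then have "AE \<omega> in M. \<omega> \<in> {\<omega> \<in> space M. merge_fun f l (P \<omega>, U \<omega>) \<le> \<alpha>} \<longrightarrow>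
      \<omega> \<in> {\<omega> \<in> space M. U \<omega> \<le> g (P \<omega>)}"
  proof eventually_elim
    case (elim \<omega>)
    show ?case
    proof safe
      assume "\<omega> \<in> space M" "merge_fun f l (P \<omega>, U \<omega>) \<le> \<alpha>"
      then have "\<beta> \<in> merge_levels f l (P \<omega>) (U \<omega>)"
        using elim \<beta> \<open>\<alpha> < \<beta>\<close> by (intro merge_levels_if_merge_fun_less f_mono) (auto intro: less_imp_le)
      then have "ennreal (U \<omega>) \<le> merge_sum f l (P \<omega>) \<beta>"
        by (simp add: merge_levels_iff)
      also have "\<dots> = T (P \<omega>)"
        unfolding merge_sum_def T_def
      proof (intro sum.cong refl)
        fix k
        have "0 < P \<omega> $ k / \<beta>" using elim \<beta> by simp
        with calibrator_finite[OF f[of k] this]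
        show "times_inf (ennreal (l $ k)) (f k (P \<omega> $ k / \<beta>)) =
            ennreal (l $ k) * f k (max 0 (P \<omega> $ k / \<beta>))"
          by (simp add: times_inf_def)
      qed
      finally have "ennreal (U \<omega>) \<le> ennreal (g (P \<omega>))"
        using U \<open>\<omega> \<in> space M\<close> by (auto simp: g_eq uniform_rvs_def)
      then show "U \<omega> \<le> g (P \<omega>)"
        using g_01[of "P \<omega>"] by (simp add: ennreal_le_iff)
    qed
  qed
  ultimately have "prob {\<omega> \<in> space M. merge_fun f l (P \<omega>, U \<omega>) \<le> \<alpha>} \<le>
      prob {\<omega> \<in> space M. U \<omega> \<le> g (P \<omega>)}"
    by (intro finite_measure_mono_AE)
  also have "\<dots> \<le> \<beta>"
  proof -
    have "ennreal (prob {\<omega> \<in> space M. U \<omega> \<le> g (P \<omega>)}) = (\<integral>\<^sup>+\<omega>. ennreal (g (P \<omega>)) \<partial>M)"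
      using emeasure_uniform_le_eq_nn_integral[OF U indep_var_borel_comp[OF P_meas U_meas g_meas ind] g_01]
      by (simp add: emeasure_eq_measure)
    also have "\<dots> \<le> (\<integral>\<^sup>+\<omega>. T (P \<omega>) \<partial>M)"
      by (intro nn_integral_mono) (simp add: g_eq)
    also have "\<dots> = (\<Sum>k\<in>UNIV. ennreal (l $ k) * (\<integral>\<^sup>+\<omega>. f k (max 0 (P \<omega> $ k / \<beta>)) \<partial>M))"
      unfolding T_def by (simp add: nn_integral_sum nn_integral_cmult)
    also have "\<dots> \<le> (\<Sum>k\<in>UNIV. ennreal (l $ k) * ennreal \<beta>)"
    proof (intro sum_mono mult_left_mono)
      fix k
      have "(\<integral>\<^sup>+\<omega>. f k (max 0 (P \<omega> $ k / \<beta>)) \<partial>M) =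
          (\<integral>\<^sup>+x\<in>{0..1}. f k (max 0 (x / \<beta>)) \<partial>lborel)"
        by (rule nn_integral_uniform_rvs[OF P[of k], where h = "\<lambda>x. f k (max 0 (x / \<beta>))"]) measurable
      also have "\<dots> \<le> ennreal \<beta>"
        using f \<beta>(1) by (rule nn_integral_calibrator_divide)
      finally show "(\<integral>\<^sup>+\<omega>. f k (max 0 (P \<omega> $ k / \<beta>)) \<partial>M) \<le> ennreal \<beta>" .
    qed simp
    also have "\<dots> = ennreal (\<Sum>k\<in>UNIV. l $ k) * ennreal \<beta>"
      by (simp add: l_nonneg flip: sum_distrib_right)
    also have "\<dots> = ennreal \<beta>"
      using l by (simp add: std_simplex_def)
    finally show ?thesis using \<beta> by simp
  qed
  finally show ?thesis .
qed

theorem theorem3p13: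
  fixes M :: "'a measure"
    and f :: "'k::finite \<Rightarrow> real \<Rightarrow> ennreal"
    and l :: "real ^ 'k"
  assumes "atomless_prob_space M"
    and "CARD('k) \<ge> 2"
    and "\<And>k. calibrator (f k)"
    and "l \<in> std_simplex"
  shows "randomized_p_merging M (merge_fun f l) \<and>
         capped_homogeneous (merge_fun f l) \<and>
         lower_semicontinuous_on unit_box (merge_fun f l)"
proof -
  interpret prob_space M using assms(1) by (simp add: atomless_prob_space_def)
  have f: "antimono_on {0..} (f k)" for k
    using assms(3) by (simp add: calibrator_def)
  \<comment> \<open>Proved first because Borel measurability is deduced from it.\<close>
  have lsc: "lower_semicontinuous_on unit_box (merge_fun f l)"
    by (rule lower_semicontinuous_on_merge_fun[OF f])
  have "merge_fun f l \<in> unit_box \<rightarrow> {0..1}"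
    by (auto simp: merge_fun_nonneg merge_fun_le_1)
  moreover have "mono_on unit_box (merge_fun f l)"
    by (intro mono_onI)
      (auto simp: unit_box_def less_eq_vec_def intro!: merge_fun_mono f)
  moreover have "prob {\<omega> \<in> space M. merge_fun f l (P \<omega>, U \<omega>) \<le> \<alpha>} \<le> \<alpha>"
    if \<alpha>: "\<alpha> \<in> {0<..<1}" and PU: "(P, U) \<in> uniform_rvecs_indep M" for \<alpha> P U
  proof (rule dense_ge_bounded[of \<alpha> 1])
    fix \<beta> assume \<beta>: "\<alpha> < \<beta>" "\<beta> < 1"
    show "prob {\<omega> \<in> space M. merge_fun f l (P \<omega>, U \<omega>) \<le> \<alpha>} \<le> \<beta>"
      using \<alpha> \<beta> by (intro prob_merge_fun_le assms(3,4) PU) auto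
  qed (use \<alpha> in simp)
  ultimately show ?thesis
    using lsc capped_homogeneous_merge_fun[OF f] lower_semicontinuous_on_imp_borel_measurable[OF lsc]
    by (auto simp: randomized_p_merging_def)
qed

end
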